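(* For every plane $\pi$ in $\mathrm{PG}(5,q)$, $q\geq 4$ even, we have $r_{2,n}(\pi)=h_1(\pi)$, i.e., the number of hyperplanes in $\mathcal{H}_1$ containing $\pi$ is equal to $\lvert \pi \cap \pi_{\mathcal{N}} \rvert$.
   Context: Points of $\mathrm{PG}(5,q)$ are identified with symmetric $3\times3$ matrices over $\mathbb{F}_q$ up to scalars. For $q$ even, $\pi_{\mathcal{N}}=\mathcal{Z}(Y_0,Y_3,Y_5)$ is the nucleus plane (zero-diagonal matrices, all of rank 2), and $r_{2,n}(\pi)$ is the number of rank-2 points of $\pi$ lying in $\pi_{\mathcal{N}}$. $\mathcal{H}_1$ is the set of hyperplanes $\mathcal{Z}(a_{00}Y_0+a_{01}Y_1+a_{02}Y_2+a_{11}Y_3+a_{12}Y_4+a_{22}Y_5)$ for which the conic $\mathcal{Z}(\sum_{i\le j}a_{ij}X_iX_j)$ of $\mathrm{PG}(2,q)$ is a double line (equivalently, hyperplanes meeting the Veronese surface in a conic), and $h_1(\pi)$ is the number of hyperplanes of $\mathcal{H}_1$ containing $\pi$. *)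

theory Defs
  imports "HOL-Analysis.Analysis"
begin

text \<open>
  The space \<open>PG(5,q)\<close> is the lattice of linear subspaces of \<open>F^6\<close>, where \<open>F\<close> is a finite field
  with \<open>q\<close> elements. The index type \<open>6\<close> is arithmetic modulo 6, so its elements \<open>0, \<dots>, 5\<close>
  are exactly the indices of the coordinates \<open>(Y_0, \<dots>, Y_5)\<close>; similarly for \<open>(X_0, X_1, X_2)\<close>.
  A projective subspace is represented by the set of its representing vectors (including 0).
\<close>

definition pg_point :: "('a::field ^ 6) set \<Rightarrow> bool" where
  "pg_point P \<longleftrightarrow> vec.subspace P \<and> vec.dim P = 1"

definition pg_plane :: "('a::field ^ 6) set \<Rightarrow> bool" where
  "pg_plane U \<longleftrightarrow> vec.subspace U \<and> vec.dim U = 3"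

definition pg_points_of :: "('a::field ^ 6) set \<Rightarrow> ('a ^ 6) set set" where
  "pg_points_of U = {P. pg_point P \<and> P \<subseteq> U}"

definition sym_matrix :: "'a::field ^ 6 \<Rightarrow> 'a ^ 3 ^ 3" where
  "sym_matrix y = vector [vector [y$0, y$1, y$2],
                          vector [y$1, y$3, y$4],
                          vector [y$2, y$4, y$5]]"

definition point_has_rank :: "('a::field ^ 6) set \<Rightarrow> nat \<Rightarrow> bool" where
  "point_has_rank P r \<longleftrightarrow> (\<forall>y\<in>P. y \<noteq> 0 \<longrightarrow> rank (sym_matrix y) = r)"

definition nucleus_plane :: "('a::field ^ 6) set" where
  "nucleus_plane = {y. y$0 = 0 \<and> y$3 = 0 \<and> y$5 = 0}"

definition r2n :: "('a::field ^ 6) set \<Rightarrow> nat" where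
  "r2n U = card {P \<in> pg_points_of U. point_has_rank P 2 \<and> P \<subseteq> nucleus_plane}"

text \<open>
  Coefficient vectors of hyperplanes and of conics are ordered as
  \<open>(a_00, a_01, a_02, a_11, a_12, a_22)\<close>.
\<close>

definition hyperplane_of :: "'a::field ^ 6 \<Rightarrow> ('a ^ 6) set" where
  "hyperplane_of a = {y. a$0 * y$0 + a$1 * y$1 + a$2 * y$2 + a$3 * y$3 + a$4 * y$4 + a$5 * y$5 = 0}"

definition conic_form :: "'a::field ^ 6 \<Rightarrow> 'a ^ 3 \<Rightarrow> 'a" where
  "conic_form a x = a$0 * x$0 * x$0 + a$1 * x$0 * x$1 + a$2 * x$0 * x$2
                  + a$3 * x$1 * x$1 + a$4 * x$1 * x$2 + a$5 * x$2 * x$2"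

text \<open>
  The conic is a double line when its form is a nonzero scalar multiple of the square of a nonzero
  linear form. A quadratic form is determined by its values (evaluate at the unit vectors and at
  sums of two of them), so equality of functions is here the same as equality of polynomials.
\<close>

definition is_double_line :: "'a::field ^ 6 \<Rightarrow> bool" where
  "is_double_line a \<longleftrightarrow> (\<exists>c (b :: 'a ^ 3). c \<noteq> 0 \<and> b \<noteq> 0 \<and>
     (\<forall>x. conic_form a x = c * (b$0 * x$0 + b$1 * x$1 + b$2 * x$2)\<^sup>2))"

definition H1 :: "('a::field ^ 6) set set" where
  "H1 = {hyperplane_of a | a. is_double_line a}"

definition h1 :: "('a::field ^ 6) set \<Rightarrow> nat" where
  "h1 U = card {H \<in> H1. U \<subseteq> H}"

end

theory Submission
  imports Defs
begin

text \<open>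
  In characteristic 2 every scalar is a square and squaring is additive, so the double lines are
  the nonzero forms without mixed terms; hence \<open>\<H>\<^sub>1\<close> consists of the hyperplanes containing the
  nucleus plane. Let \<open>D\<close> be the 3-dimensional space of coefficient vectors of such forms. Under
  the pairing of \<open>D\<close> with \<open>\<pi>\<close> the radical in \<open>\<pi>\<close> is \<open>\<pi> \<inter> \<pi>\<^sub>N\<close> and the radical in \<open>D\<close>
  describes the hyperplanes of \<open>\<H>\<^sub>1\<close> through \<open>\<pi>\<close>. As \<open>D\<close> and \<open>\<pi>\<close> have the same size, so
  have the two radicals, and therefore they have the same number of one-dimensional subspaces.
\<close>

section \<open>Indices modulo 6 and modulo 3, and counting by fibres\<close>

lemma UNIV_6: "(UNIV::6 set) = {0,1,2,3,4,5}"
proof -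
  have "card {0,1,2,3,4,5::6} = CARD(6)" by simp
  then show ?thesis by (intro card_subset_eq[symmetric]) auto
qed

lemma sum_6: "sum f (UNIV::6 set) = f 0 + f 1 + f 2 + f 3 + f 4 + f 5"
  for f :: "6 \<Rightarrow> 'a::comm_monoid_add"
  unfolding UNIV_6 by (simp add: add.assoc)

lemma forall_6: "(\<forall>i::6. P i) \<longleftrightarrow> P 0 \<and> P 1 \<and> P 2 \<and> P 3 \<and> P 4 \<and> P 5"
proof -
  have "(\<forall>i::6. P i) \<longleftrightarrow> (\<forall>i\<in>UNIV. P i)" by simp
  then show ?thesis unfolding UNIV_6 by simp
qed

text \<open>Reconciles \<open>forall_3\<close> and \<open>vector_3\<close>, which speak of the
  indices 1, 2, 3, with the coordinates 0, 1, 2 of the conic.\<close>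

lemma three_eq_zero: "(3::3) = 0"
  by simp

lemma card_eq_mult_card_image:
  assumes "finite S" and "\<And>x. x \<in> S \<Longrightarrow> card {y \<in> S. f y = f x} = k"
  shows "card S = k * card (f ` S)"
proof -
  have "card S = (\<Sum>z\<in>f ` S. \<Sum>y\<in>{y \<in> S. f y = z}. 1)"
    using sum.image_gen[OF \<open>finite S\<close>, of "\<lambda>_. 1::nat" f] by simp
  also have "\<dots> = (\<Sum>z\<in>f ` S. k)" using assms(2) by (intro sum.cong) auto
  finally show ?thesis by simp
qed

section \<open>Finite fields of even order\<close>

text \<open>If 2 were nonzero, the map from x to {x, -x} would be two-to-one on the nonzero
  elements, making q - 1 even.\<close>

lemma even_CARD_imp_two_eq_zero:
  assumes "even CARD('a::{field,finite})"
  shows "(2::'a) = 0"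
proof (rule ccontr)
  assume two: "(2::'a) \<noteq> 0"
  have "card (UNIV - {0::'a}) = 2 * card ((\<lambda>x::'a. {x, - x}) ` (UNIV - {0}))"
  proof (rule card_eq_mult_card_image)
    fix x :: 'a assume "x \<in> UNIV - {0}"
    then have "x + x \<noteq> 0" using two by (metis DiffD2 insertI1 mult_2 mult_eq_0_iff)
    then have "x \<noteq> - x" by (metis add.right_inverse)
    moreover have "{y \<in> UNIV - {0}. {y, - y} = {x, - x}} = {x, - x}"
      using \<open>x \<in> _\<close> by (auto simp: doubleton_eq_iff)
    ultimately show "card {y \<in> UNIV - {0}. {y, - y} = {x, - x}} = 2" by simp
  qed simp
  then have "even (CARD('a) - 1)" by (simp add: card_Diff_subset)
  moreover have "CARD('a) > 0" by (simp add: card_gt_0_iff)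
  ultimately show False using assms by simp
qed

text \<open>Squaring is injective, since the two roots y and -y coincide, and an injective self-map
  of a finite set is onto.\<close>

lemma power2_surj_char_two:
  assumes "(2::'a::{field,finite}) = 0"
  shows "\<exists>y. y\<^sup>2 = (x::'a)"
proof -
  have "inj (\<lambda>y::'a. y\<^sup>2)"
  proof (rule injI)
    fix y z :: 'a assume "y\<^sup>2 = z\<^sup>2"
    then have "y = z \<or> y = - z" by (simp add: power2_eq_iff)
    moreover have "- z = z" using assms by (metis add_eq_0_iff mult_2 mult_zero_left)
    ultimately show "y = z" by auto
  qed
  then have "surj (\<lambda>y::'a. y\<^sup>2)" by (simp add: finite_UNIV_inj_surj)
  then show ?thesis by (metis surjD)
qed

text \<open>Turns vector counts into projective counts: each fibre of \<open>f\<close> is the set of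
  the q - 1 nonzero multiples of one vector. It is meant both for points and for hyperplanes given
  by coefficients.\<close>

lemma card_image_proportional:
  fixes S :: "('a::{field,finite} ^ 'n) set"
  assumes sc: "\<And>c x. x \<in> S \<Longrightarrow> c *s x \<in> S"
    and f: "\<And>x y. \<lbrakk>x \<in> S; y \<in> S; x \<noteq> 0; y \<noteq> 0\<rbrakk> \<Longrightarrow> f y = f x \<longleftrightarrow> (\<exists>c. y = c *s x)"
  shows "card (S - {0}) = (CARD('a) - 1) * card (f ` (S - {0}))"
proof (rule card_eq_mult_card_image)
  fix x assume x: "x \<in> S - {0}"
  have "{y \<in> S - {0}. f y = f x} = (\<lambda>c. c *s x) ` (UNIV - {0})"
    using x f sc by auto
  moreover have "inj_on (\<lambda>c. c *s x) (UNIV - {0})"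
    using x by (auto simp: inj_on_def)
  ultimately show "card {y \<in> S - {0}. f y = f x} = CARD('a) - 1"
    by (simp add: card_image card_Diff_subset)
qed simp

section \<open>Orthogonality counts for the standard bilinear form\<close>

definition dot :: "'a::field ^ 'n \<Rightarrow> 'a ^ 'n \<Rightarrow> 'a" where
  "dot x y = (\<Sum>i\<in>UNIV. x $ i * y $ i)"

lemma dot_commute: "dot x y = dot y x"
  by (simp add: dot_def mult.commute)

lemma dot_add_right: "dot x (y + z) = dot x y + dot x z"
  by (simp add: dot_def distrib_left sum.distrib)

lemma dot_diff_right: "dot x (y - z) = dot x y - dot x z"
  by (simp add: dot_def right_diff_distrib sum_subtractf)

lemma dot_scale_right: "dot x (c *s y) = c * dot x y"
  by (simp add: dot_def sum_distrib_left algebra_simps)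

lemma dot_scale_left: "dot (c *s x) y = c * dot x y"
  by (simp add: dot_def sum_distrib_left algebra_simps)

lemma dot_zero_left [simp]: "dot 0 y = 0"
  by (simp add: dot_def)

lemma dot_axis: "dot x (axis i c) = x $ i * c"
  by (simp add: dot_def axis_def if_distrib cong: if_cong)

text \<open>A linear functional that is nonzero on \<open>S\<close> maps \<open>S\<close> onto the
  field, and its fibres are translates of its kernel.\<close>

lemma card_dot_kernel:
  fixes S :: "('a::{field,finite} ^ 'n) set"
  assumes S: "vec.subspace S" and v: "v \<in> S" "dot a v \<noteq> 0"
  shows "card S = CARD('a) * card {y \<in> S. dot a y = 0}"
proof -
  have "dot a ` S = UNIV"
  proof -
    have "c \<in> dot a ` S" for c
    proof
      show "c = dot a ((c / dot a v) *s v)" using v by (simp add: dot_scale_right)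
      show "(c / dot a v) *s v \<in> S" using S v by (simp add: vec.subspace_scale)
    qed
    then show ?thesis by auto
  qed
  moreover have "card S = card {y \<in> S. dot a y = 0} * card (dot a ` S)"
  proof (rule card_eq_mult_card_image)
    fix x assume x: "x \<in> S"
    have "bij_betw (\<lambda>y. y + x) {y \<in> S. dot a y = 0} {y \<in> S. dot a y = dot a x}"
      by (rule bij_betw_byWitness[where f' = "\<lambda>y. y - x"])
        (use S x in \<open>auto simp: dot_add_right dot_diff_right vec.subspace_add vec.subspace_diff\<close>)
    then show "card {y \<in> S. dot a y = dot a x} = card {y \<in> S. dot a y = 0}"
      by (simp add: bij_betw_same_card)
  qed simp
  ultimately show ?thesis by simp
qed

text \<open>After multiplication by q, which avoids division, each \<open>a\<close> in
  \<open>T\<close> contributes \<open>card S\<close>, and those orthogonal to all of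
  \<open>S\<close> contribute (q - 1) \<open>card S\<close> more.\<close>

lemma card_dot_pairs:
  fixes S T :: "('a::{field,finite} ^ 'n) set"
  assumes S: "vec.subspace S"
  shows "CARD('a) * (\<Sum>a\<in>T. card {y \<in> S. dot a y = 0})
    = card S * card T + (CARD('a) - 1) * card S * card {a \<in> T. \<forall>y\<in>S. dot a y = 0}"
proof -
  let ?q = "CARD('a)" and ?R = "{a \<in> T. \<forall>y\<in>S. dot a y = 0}"
  obtain k where q: "?q = Suc k" using card_gt_0_iff[of "UNIV::'a set"] by (cases ?q) auto
  have *: "?q * card {y \<in> S. dot a y = 0}
      = card S + (if a \<in> ?R then (?q - 1) * card S else 0)" if a: "a \<in> T" for a
  proof (cases "a \<in> ?R")
    case True
    then have "{y \<in> S. dot a y = 0} = S" by auto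
    then show ?thesis using True by (simp add: q)
  next
    case False
    then obtain v where "v \<in> S" "dot a v \<noteq> 0" using a by blast
    from card_dot_kernel[OF S this] False show ?thesis by (simp only: if_False add_0_right)
  qed
  have "?q * (\<Sum>a\<in>T. card {y \<in> S. dot a y = 0})
      = (\<Sum>a\<in>T. card S + (if a \<in> ?R then (?q - 1) * card S else 0))"
    unfolding sum_distrib_left by (intro sum.cong refl *)
  also have "\<dots> = card S * card T + (\<Sum>a\<in>T. if a \<in> ?R then (?q - 1) * card S else 0)"
    by (simp add: sum.distrib)
  also have "(\<Sum>a\<in>T. if a \<in> ?R then (?q - 1) * card S else 0) = (\<Sum>a\<in>?R. (?q - 1) * card S)"
    by (intro sum.mono_neutral_cong_right) auto
  finally show ?thesis by simp
qed

text \<open>Count the orthogonal pairs in \<open>T \<times> S\<close> by either coordinate.\<close>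

lemma card_dot_radicals_eq:
  fixes S T :: "('a::{field,finite} ^ 'n) set"
  assumes S: "vec.subspace S" and T: "vec.subspace T" and card: "card S = card T"
  shows "card {y \<in> S. \<forall>a\<in>T. dot a y = 0} = card {a \<in> T. \<forall>y\<in>S. dot a y = 0}"
proof -
  let ?q = "CARD('a)"
  have "(\<Sum>a\<in>T. card {y \<in> S. dot a y = 0}) = (\<Sum>y\<in>S. card {a \<in> T. dot a y = 0})"
    using sum.swap_restrict[of T S "\<lambda>_ _. 1::nat" "\<lambda>a y. dot a y = 0"] by simp
  also have "\<dots> = (\<Sum>y\<in>S. card {a \<in> T. dot y a = 0})"
    by (subst dot_commute) (rule refl)
  finally have "card S * card T + (?q - 1) * card S * card {a \<in> T. \<forall>y\<in>S. dot a y = 0}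
      = card T * card S + (?q - 1) * card T * card {y \<in> S. \<forall>a\<in>T. dot y a = 0}"
    using card_dot_pairs[OF S, of T] card_dot_pairs[OF T, of S] by metis
  then have "(?q - 1) * card S * card {a \<in> T. \<forall>y\<in>S. dot a y = 0}
      = (?q - 1) * card S * card {y \<in> S. \<forall>a\<in>T. dot y a = 0}"
    unfolding card by (simp only: add_left_cancel)
  \<comment> \<open>Together with \<open>S\<close> being nonempty, this makes the common factor (q -
    1) \<open>card S\<close> positive, so it cancels.\<close>
  moreover have "?q > 1"
    using card_mono[of "UNIV::'a set" "{0,1}"] by simp
  moreover have "S \<noteq> {}"
    using vec.subspace_0[OF S] by auto
  ultimately have "card {a \<in> T. \<forall>y\<in>S. dot a y = 0} = card {y \<in> S. \<forall>a\<in>T. dot y a = 0}"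
    by simp
  also have "\<dots> = card {y \<in> S. \<forall>a\<in>T. dot a y = 0}"
    by (subst dot_commute) (rule refl)
  finally show ?thesis by (rule sym)
qed

section \<open>Hyperplanes and points up to scalars\<close>

lemma hyperplane_of_eq_dot: "hyperplane_of a = {y. dot a y = 0}"
  by (simp add: hyperplane_of_def dot_def sum_6)

lemma hyperplane_of_eq_iff:
  assumes "a \<noteq> 0" "b \<noteq> 0"
  shows "hyperplane_of b = hyperplane_of a \<longleftrightarrow> (\<exists>c. b = c *s a)"
proof
  assume eq: "hyperplane_of b = hyperplane_of a"
  obtain i where i: "a $ i \<noteq> 0" using \<open>a \<noteq> 0\<close> by (auto simp: vec_eq_iff)
  have "b $ j = b $ i / a $ i * a $ j" for j
  proof -
    \<comment> \<open>This vector is orthogonal to \<open>a\<close> by design; its orthogonality to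
      \<open>b\<close> says that \<open>b $ j * a $ i = b $ i * a $ j\<close>.\<close>
    have "axis j (a $ i) - axis i (a $ j) \<in> hyperplane_of a"
      by (simp add: hyperplane_of_eq_dot dot_diff_right dot_axis)
    then have "axis j (a $ i) - axis i (a $ j) \<in> hyperplane_of b" using eq by simp
    then show ?thesis using i
      by (simp add: hyperplane_of_eq_dot dot_diff_right dot_axis field_simps)
  qed
  then have "b = (b $ i / a $ i) *s a" unfolding vec_eq_iff vector_smult_component by blast
  then show "\<exists>c. b = c *s a" by blast
next
  assume "\<exists>c. b = c *s a"
  then obtain c where c: "b = c *s a" by blast
  with assms have "c \<noteq> 0" by auto
  then show "hyperplane_of b = hyperplane_of a"
    using c by (simp add: hyperplane_of_eq_dot dot_scale_left)
qed

lemma span_singleton_eq_iff: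
  fixes x y :: "'a::field ^ 'n"
  assumes "x \<noteq> 0" "y \<noteq> 0"
  shows "vec.span {y} = vec.span {x} \<longleftrightarrow> (\<exists>c. y = c *s x)"
proof
  assume "vec.span {y} = vec.span {x}"
  then have "y \<in> vec.span {x}" using vec.span_base[of y "{y}"] by simp
  then show "\<exists>c. y = c *s x" by (auto simp: vec.span_singleton)
next
  assume "\<exists>c. y = c *s x"
  then obtain c where c: "y = c *s x" by blast
  with assms have "c \<noteq> 0" by auto
  then have "x = (1 / c) *s y" using c by (simp add: vec_eq_iff)
  then have "x \<in> vec.span {y}" by (auto simp: vec.span_singleton)
  moreover have "y \<in> vec.span {x}" using c by (auto simp: vec.span_singleton)
  ultimately show "vec.span {y} = vec.span {x}"
    by (simp add: vec.span_eq)
qed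

lemma pg_point_iff: "pg_point P \<longleftrightarrow> (\<exists>x. x \<noteq> 0 \<and> P = vec.span {x})"
proof
  assume P: "pg_point P"
  then obtain B where B: "B \<subseteq> P" "vec.independent B" "P \<subseteq> vec.span B" "card B = 1"
    using vec.basis_exists[of P] by (auto simp: pg_point_def)
  then obtain x where x: "B = {x}" by (auto simp: card_1_singleton_iff)
  have "vec.span B = P"
    using B P by (intro vec.span_subspace) (auto simp: pg_point_def)
  then show "\<exists>x. x \<noteq> 0 \<and> P = vec.span {x}" using B x by auto
next
  assume "\<exists>x. x \<noteq> 0 \<and> P = vec.span {x}"
  then show "pg_point P" by (auto simp: pg_point_def vec.dim_insert)
qed

lemma pg_points_of_subspace:
  assumes "vec.subspace U"
  shows "pg_points_of U = (\<lambda>x. vec.span {x}) ` (U - {0})"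
proof -
  have "vec.span {x} \<subseteq> U \<longleftrightarrow> x \<in> U" for x
    using assms vec.span_minimal[of "{x}" U] vec.span_base[of x "{x}"] by blast
  then show ?thesis by (auto simp: pg_points_of_def pg_point_iff)
qed

section \<open>Double lines and the nucleus plane in characteristic two\<close>

lemma is_double_line_iff_char_two:
  fixes a :: "'a::{field,finite} ^ 6"
  assumes two: "(2::'a) = 0"
  shows "is_double_line a \<longleftrightarrow> a \<noteq> 0 \<and> a $ 1 = 0 \<and> a $ 2 = 0 \<and> a $ 4 = 0"
proof
  assume "is_double_line a"
  then obtain c and b :: "'a ^ 3" where cb: "c \<noteq> 0" "b \<noteq> 0"
    and eq: "\<And>x. conic_form a x = c * (b$0 * x$0 + b$1 * x$1 + b$2 * x$2)\<^sup>2"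
    by (auto simp: is_double_line_def)
  have sq: "(s + t)\<^sup>2 = s\<^sup>2 + t\<^sup>2" for s t :: 'a using two by (simp add: power2_sum)
  have e0: "a$0 = c * (b$0)\<^sup>2" and e1: "a$3 = c * (b$1)\<^sup>2" and e2: "a$5 = c * (b$2)\<^sup>2"
    using eq[of "axis 0 1"] eq[of "axis 1 1"] eq[of "axis 2 1"]
    by (simp_all add: conic_form_def axis_def)
  \<comment> \<open>At the sum of two unit vectors, the additive square on the right already
    accounts for both diagonal coefficients, so nothing is left for the mixed one.\<close>
  have "a$1 = 0" "a$2 = 0" "a$4 = 0"
    using eq[of "axis 0 1 + axis 1 1"] eq[of "axis 0 1 + axis 2 1"] eq[of "axis 1 1 + axis 2 1"]
    by (simp_all add: conic_form_def axis_def e0 e1 e2 sq distrib_left)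
  moreover have "b$0 \<noteq> 0 \<or> b$1 \<noteq> 0 \<or> b$2 \<noteq> 0"
    using \<open>b \<noteq> 0\<close> by (auto simp: vec_eq_iff forall_3 three_eq_zero)
  then have "a \<noteq> 0" using e0 e1 e2 \<open>c \<noteq> 0\<close> by auto
  ultimately show "a \<noteq> 0 \<and> a $ 1 = 0 \<and> a $ 2 = 0 \<and> a $ 4 = 0" by simp
next
  assume a: "a \<noteq> 0 \<and> a $ 1 = 0 \<and> a $ 2 = 0 \<and> a $ 4 = 0"
  have sq: "(s + t)\<^sup>2 = s\<^sup>2 + t\<^sup>2" for s t :: 'a using two by (simp add: power2_sum)
  obtain r0 r1 r2 where r: "r0\<^sup>2 = a$0" "r1\<^sup>2 = a$3" "r2\<^sup>2 = a$5"
    using power2_surj_char_two[OF two] by metis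
  \<comment> \<open>The root \<open>r0\<close> comes last because \<open>vector\<close> fills the
    indices 1, 2, 3, and 3 is 0 here.\<close>
  define b :: "'a ^ 3" where "b = vector [r1, r2, r0]"
  have b: "b$0 = r0" "b$1 = r1" "b$2 = r2"
    using vector_3[of r1 r2 r0] by (simp_all add: b_def three_eq_zero)
  have "a$0 \<noteq> 0 \<or> a$3 \<noteq> 0 \<or> a$5 \<noteq> 0"
    using a by (auto simp: vec_eq_iff forall_6)
  then have "b \<noteq> 0" using r b by auto
  moreover have "conic_form a x = 1 * (b$0 * x$0 + b$1 * x$1 + b$2 * x$2)\<^sup>2" for x
    using a by (simp add: conic_form_def b sq power_mult_distrib r power2_eq_square[of "x$_"] mult.assoc)
  ultimately show "is_double_line a"
    unfolding is_double_line_def by (metis one_neq_zero)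
qed

text \<open>In characteristic 2 the rows satisfy
  \<open>y$4 *s r1 + y$2 *s r2 + y$1 *s r3 = 0\<close>. Solving for a row with nonzero coefficient
  bounds the rank by 2; the same nonzero entry makes the other two rows independent.\<close>

lemma rank_sym_matrix_nucleus:
  fixes y :: "'a::field ^ 6"
  assumes two: "(2::'a) = 0" and y: "y \<in> nucleus_plane" "y \<noteq> 0"
  shows "rank (sym_matrix y) = 2"
proof -
  have neg: "- t = t" for t :: 'a using two by (metis add_eq_0_iff mult_2 mult_zero_left)
  define r1 r2 r3 :: "'a ^ 3"
    where "r1 = vector [0, y$1, y$2]" and "r2 = vector [y$1, 0, y$4]" and "r3 = vector [y$2, y$4, 0]"
  note r = r1_def r2_def r3_def
  have "rows (sym_matrix y) = {r1, r2, r3}"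
  proof -
    have "rows (sym_matrix y) = range (\<lambda>i. row i (sym_matrix y))" by (auto simp: rows_def)
    then show ?thesis
      using y by (simp add: UNIV_3 row_def sym_matrix_def nucleus_plane_def r)
  qed
  then have rank: "rank (sym_matrix y) = vec.dim {r1, r2, r3}"
    by (simp add: row_rank_def_gen)
  \<comment> \<open>Below, \<open>w\<close> is the row solved for, and \<open>k\<close> and
    \<open>l\<close> are quotients of coefficients of the row relation; signs vanish by
    \<open>neg\<close>.\<close>
  have dim: "vec.dim {u, v, w} = 2"
    if "v \<noteq> 0" "\<And>k. u \<noteq> k *s v" "w = k *s u + l *s v" for u v w :: "'a ^ 3" and k l
  proof -
    have "u \<notin> vec.span {v}" using that by (auto simp: vec.span_singleton)
    moreover have "w \<in> vec.span {u, v}" unfolding that(3)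
      by (intro vec.span_add vec.span_scale vec.span_base) auto
    ultimately have "vec.dim (insert w {u, v}) = 2" using that by (simp add: vec.dim_insert)
    then show ?thesis by (simp add: insert_commute)
  qed
  have "y$1 \<noteq> 0 \<or> y$2 \<noteq> 0 \<or> y$4 \<noteq> 0"
    using y by (auto simp: vec_eq_iff forall_6 nucleus_plane_def)
  then consider "y$1 \<noteq> 0" | "y$2 \<noteq> 0" | "y$4 \<noteq> 0" by blast
  then show ?thesis
  proof cases
    case 1
    then have "vec.dim {r1, r2, r3} = 2"
      by (intro dim[where k = "y$4 / y$1" and l = "y$2 / y$1"])
        (auto simp: r vec_eq_iff forall_3 field_simps neg two)
    then show ?thesis using rank by simp
  next
    case 2
    then have "vec.dim {r1, r3, r2} = 2"
      by (intro dim[where k = "y$4 / y$2" and l = "y$1 / y$2"])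
        (auto simp: r vec_eq_iff forall_3 field_simps neg two)
    then show ?thesis using rank by (simp add: insert_commute)
  next
    case 3
    then have "vec.dim {r2, r3, r1} = 2"
      by (intro dim[where k = "y$2 / y$4" and l = "y$1 / y$4"])
        (auto simp: r vec_eq_iff forall_3 field_simps neg two)
    then show ?thesis using rank by (simp add: insert_commute)
  qed
qed

section \<open>Pairing a plane with the space of diagonal forms\<close>

theorem theorem3p7:
  fixes \<pi> :: "('a::{field,finite} ^ 6) set"
  assumes "even CARD('a)" and "CARD('a) \<ge> 4"
    and "pg_plane \<pi>"
  shows "r2n \<pi> = h1 \<pi> \<and> h1 \<pi> = card (pg_points_of (\<pi> \<inter> nucleus_plane))"
proof -
  have two: "(2::'a) = 0" by (rule even_CARD_imp_two_eq_zero[OF assms(1)])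
  have pi: "vec.subspace \<pi>" "vec.dim \<pi> = 3" using assms(3) by (auto simp: pg_plane_def)
  \<comment> \<open>The positions 0, 3, 5 carry the coefficients of the squares; the form with an
    index set matches \<open>dim_substandard_cart\<close>.\<close>
  define D :: "('a ^ 6) set" where "D = {a. \<forall>i. i \<notin> {0, 3, 5} \<longrightarrow> a $ i = 0}"
  define A where "A = {a \<in> D. \<forall>y\<in>\<pi>. dot a y = 0}"
  let ?W = "\<pi> \<inter> nucleus_plane"
  have D_iff: "a \<in> D \<longleftrightarrow> a$1 = 0 \<and> a$2 = 0 \<and> a$4 = 0" for a
    by (simp add: D_def forall_6)
  have D: "vec.subspace D" by (auto simp: vec.subspace_def D_iff)
  have N: "vec.subspace (nucleus_plane :: ('a ^ 6) set)"
    by (auto simp: vec.subspace_def nucleus_plane_def)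
  have W: "vec.subspace ?W" using pi N by (simp add: vec.subspace_inter)
  have "vec.dim D = 3" unfolding D_def dim_substandard_cart by simp
  \<comment> \<open>Equal dimension yields a linear bijection, hence the equal cardinalities
    required for comparing the radicals.\<close>
  then obtain f where "f ` \<pi> = D" "inj_on f \<pi>"
    using vec.subspace_isomorphism[OF pi(1) D] pi(2) by metis
  then have "card \<pi> = card D" by (metis card_image)
  moreover have "?W = {y \<in> \<pi>. \<forall>a\<in>D. dot a y = 0}"
  proof -
    have "y \<in> nucleus_plane \<longleftrightarrow> (\<forall>a\<in>D. dot a y = 0)" for y
    proof
      assume "y \<in> nucleus_plane"
      then show "\<forall>a\<in>D. dot a y = 0" by (auto simp: nucleus_plane_def D_iff dot_def sum_6)
    next
      assume *: "\<forall>a\<in>D. dot a y = 0"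
      \<comment> \<open>Pairing with these three unit vectors reads off the diagonal coordinates of
        \<open>y\<close>.\<close>
      have "axis 0 1 \<in> D" "axis 3 1 \<in> D" "axis 5 1 \<in> D" by (auto simp: D_iff axis_def)
      with * show "y \<in> nucleus_plane"
        by (simp add: nucleus_plane_def) (metis dot_commute dot_axis mult_1_right)
    qed
    then show ?thesis by auto
  qed
  ultimately have "card ?W = card A"
    unfolding A_def using card_dot_radicals_eq[OF pi(1) D] by simp
  moreover have "0 \<in> A" "0 \<in> ?W"
    using vec.subspace_0[OF W] by (auto simp: A_def D_iff)
  ultimately have "card (?W - {0}) = card (A - {0})" by simp
  moreover have "card (?W - {0}) = (CARD('a) - 1) * card ((\<lambda>x. vec.span {x}) ` (?W - {0}))"
    by (intro card_image_proportional span_singleton_eq_iff vec.subspace_scale[OF W])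
  moreover have "card (A - {0}) = (CARD('a) - 1) * card (hyperplane_of ` (A - {0}))"
    by (intro card_image_proportional hyperplane_of_eq_iff)
      (auto simp: A_def D_iff dot_scale_left)
  \<comment> \<open>Both sets of nonzero vectors are q - 1 times their projective counts, and q - 1
    is positive.\<close>
  ultimately have "card (pg_points_of ?W) = card (hyperplane_of ` (A - {0}))"
    using assms(2) by (simp add: pg_points_of_subspace[OF W])
  \<comment> \<open>The nonzero vectors of \<open>D\<close> are exactly the double lines, and
    membership in \<open>A\<close> adds that the hyperplane contains the plane.\<close>
  moreover have "{H \<in> H1. \<pi> \<subseteq> H} = hyperplane_of ` (A - {0})"
    by (auto simp: H1_def is_double_line_iff_char_two[OF two] A_def D_iff hyperplane_of_eq_dot)
  moreover have "{P \<in> pg_points_of \<pi>. point_has_rank P 2 \<and> P \<subseteq> nucleus_plane} = pg_points_of ?W"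
    using rank_sym_matrix_nucleus[OF two] by (auto simp: pg_points_of_def point_has_rank_def)
  ultimately show ?thesis by (simp add: r2n_def h1_def)
qed

end
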